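(* There is a sequence of monic polynomials $(\Phi_n(x))_{n\ge 1}$ with $\Phi_n(x)\in\mathbb{Z}[x]$ such that for every $n \ge 1$ $$(-1)^{n-1} Z_n(x) = \prod_{d\mid n} \Phi_d(x) \quad\text{and}\quad \deg \Phi_d(x) = \varphi(d),$$ where $\varphi$ is Euler's totient function. Moreover, if $\phi_n(x)$ denotes the minimal polynomial (over $\mathbb{Q}$) of $4\sin^2(\pi/n)$, then $\Phi_1(x) = \phi_1(x) = x$, $\Phi_2(x) = \phi_2(x) = x-4$, and $\Phi_n(x) = \phi_n(x)^2$ for $n \ge 3$.
   Context: The polynomials $l_n(x)$ are defined by $l_0(x)=2$, $l_1(x)=x$, $l_n(x) = xl_{n-1}(x) - l_{n-2}(x)$ for $n\ge 2$ (so $l_n(x)=2T_n(x/2)$ with $T_n$ the Chebyshev polynomial of the first kind). Define $Z_n(x) = 2 - l_n(2-x)$; equivalently $Z_n(x) = 4S_n(x/4)$ with $S_n(x) = \frac{1-T_n(1-2x)}{2}$ the spread polynomials, and $Z_n(4\sin^2\theta) = 4\sin^2(n\theta)$. *)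

theory Defs
  imports
    Complex_Main
    "HOL-Computational_Algebra.Polynomial"
    "HOL-Number_Theory.Totient"
begin

fun l_poly :: "nat \<Rightarrow> int poly" where
  "l_poly 0 = [:2:]"
| "l_poly (Suc 0) = [:0, 1:]"
| "l_poly (Suc (Suc n)) = [:0, 1:] * l_poly (Suc n) - l_poly n"

definition Z_poly :: "nat \<Rightarrow> int poly" where
  "Z_poly n = 2 - pcompose (l_poly n) [:2, -1:]"

definition is_min_poly_rat :: "real \<Rightarrow> rat poly \<Rightarrow> bool" where
  "is_min_poly_rat a p \<longleftrightarrow>
     lead_coeff p = 1 \<and> poly (map_poly of_rat p) a = 0 \<and>
     (\<forall>q. q \<noteq> 0 \<and> poly (map_poly of_rat q) a = 0 \<longrightarrow> degree p \<le> degree q)"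

text \<open>Only meaningful for algebraic numbers, as \<open>min_poly_rat_correct\<close> shows.\<close>

definition min_poly_rat :: "real \<Rightarrow> rat poly" where
  "min_poly_rat a = (THE p. is_min_poly_rat a p)"

lemma is_min_poly_rat_unique:
  assumes p: "is_min_poly_rat a p" and q: "is_min_poly_rat a q"
  shows "p = q"
proof (rule ccontr)
  assume neq: "p \<noteq> q"
  have deg: "degree p = degree q"
    using p q unfolding is_min_poly_rat_def
    by (metis leading_coeff_0_iff le_antisym zero_neq_one)
  have map_diff: "map_poly of_rat (p - q) = (map_poly of_rat p - map_poly of_rat q :: real poly)"
    by (rule poly_eqI) (simp add: coeff_map_poly of_rat_diff)
  have root: "poly (map_poly of_rat (p - q)) a = 0"
    using p q by (simp add: map_diff is_min_poly_rat_def)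
  have le: "degree p \<le> degree (p - q)"
    using p root neq unfolding is_min_poly_rat_def by (metis eq_iff_diff_eq_0)
  have "degree (p - q) \<le> degree p"
    using degree_diff_le_max[of p q] deg by simp
  with le have "degree (p - q) = degree p" by simp
  then have "lead_coeff (p - q) = 0"
    using p q deg by (simp add: is_min_poly_rat_def)
  then have "p - q = 0" by (simp only: leading_coeff_0_iff)
  with neq show False by simp
qed

lemma min_poly_rat_correct:
  assumes "algebraic a"
  shows "is_min_poly_rat a (min_poly_rat a)"
proof -
  let ?R = "\<lambda>p :: rat poly. p \<noteq> 0 \<and> poly (map_poly of_rat p) a = 0"
  obtain f where f: "\<And>i. coeff f i \<in> \<int>" "f \<noteq> 0" "poly f a = 0"
    using algebraicE[OF assms] by blast
  define g :: "rat poly" where "g = map_poly (\<lambda>x. of_int \<lfloor>x\<rfloor>) f"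
  have fg: "map_poly of_rat g = f"
    by (rule poly_eqI) (use f(1) in \<open>auto simp: g_def coeff_map_poly elim!: Ints_cases\<close>)
  have "?R g" using f fg by auto
  then obtain p where p: "?R p" "\<And>q. ?R q \<Longrightarrow> degree p \<le> degree q"
    using ex_has_least_nat[of ?R g degree] by blast
  let ?p = "smult (inverse (lead_coeff p)) p"
  have "map_poly of_rat ?p = smult (of_rat (inverse (lead_coeff p))) (map_poly of_rat p :: real poly)"
    by (rule poly_eqI) (simp add: coeff_map_poly of_rat_mult)
  then have "is_min_poly_rat a ?p"
    using p by (simp add: is_min_poly_rat_def)
  then show ?thesis
    unfolding min_poly_rat_def by (metis is_min_poly_rat_unique theI)
qed

end

(* Writing 4 sin^2 (pi k / n) = 2 - w - 1/w with w = cis (2 pi k / n), the substitution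
   x = 2 - z - 1/z turns Z_n into 2 - z^n - z^(-n) = - (z^n - 1)^2 / z^n, so
   (-1)^(n-1) Z_n is the product of all x - 4 sin^2 (pi k / n), 0 < k <= n. Grouping the k by
   gcd k n gives Phi_d as the product over the totatives of d; it is integral by induction,
   since a quotient of monic integer polynomials is integral. For n >= 3 the roots pair up
   under k -> n - k, so Phi_n is a square, and a monic square root of a rational polynomial
   is rational. That this square root is the minimal polynomial amounts to the irreducibility
   of the cyclotomic polynomials. *)

theory Submission
  imports Defs "Subresultants.More_Homomorphisms"
begin

hide_const (open) module.smult


abbreviation ipoly :: "int poly \<Rightarrow> 'a :: comm_ring_1 \<Rightarrow> 'a" where
  "ipoly f x \<equiv> poly (map_poly of_int f) x"

section \<open>Frobenius congruence for integer polynomials modulo a prime\<close>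

lemma prime_dvd_freshmans_dream:
  fixes a b :: "'a :: comm_ring_1"
  assumes "prime p"
  shows "of_nat p dvd (a + b) ^ p - a ^ p - b ^ p"
proof -
  have p: "p > 1" using assms by (rule prime_gt_1_nat)
  then have split: "{..p} = insert 0 (insert p {0<..<p})" by auto
  have "(a + b) ^ p - a ^ p - b ^ p
      = (\<Sum>k\<in>{0<..<p}. of_nat (p choose k) * a ^ k * b ^ (p - k))"
    using p by (simp add: binomial_ring split)
  also have "of_nat p dvd \<dots>"
  proof (intro dvd_sum dvd_mult2)
    fix k assume "k \<in> {0<..<p}"
    then have "p dvd p choose k" using assms by (intro dvd_choose_prime) auto
    then show "of_nat p dvd (of_nat (p choose k) :: 'a)"
      by (metis dvd_def of_nat_mult)
  qed
  finally show ?thesis .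
qed

text \<open>For a polynomial a + X f, the p-th power splits modulo p; Fermat's little theorem
  absorbs the constant a, and the induction hypothesis handles f.\<close>

lemma prime_dvd_poly_frobenius:
  fixes f :: "int poly"
  assumes "prime p"
  shows "of_nat p dvd f \<circ>\<^sub>p monom 1 p - f ^ p"
proof (induction f)
  case 0
  then show ?case using prime_gt_0_nat[OF assms] by (simp add: power_0_left)
next
  case (pCons a f)
  let ?X = "[:0, 1:] :: int poly"
  \<comment> \<open>Fermat's little theorem is the freshman's dream with second summand 1, run
    upwards and downwards over the integers.\<close>
  have fermat: "int p dvd a ^ p - a"
  proof (induction a rule: int_induct[where k = 0])
    case base
    then show ?case using prime_gt_0_nat[OF assms] by (simp add: power_0_left)
  next
    case (step1 i)
    have "int p dvd ((i + 1) ^ p - i ^ p - 1 ^ p) + (i ^ p - i)"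
      using prime_dvd_freshmans_dream[OF assms] step1.IH by (rule dvd_add)
    also have "\<dots> = (i + 1) ^ p - (i + 1)" by simp
    finally show ?case .
  next
    case (step2 i)
    have "int p dvd (i ^ p - i) - ((i - 1 + 1) ^ p - (i - 1) ^ p - 1 ^ p)"
      using step2.IH prime_dvd_freshmans_dream[OF assms] by (rule dvd_diff)
    also have "\<dots> = (i - 1) ^ p - (i - 1)" by simp
    finally show ?case .
  qed
  have const: "[:a:] ^ p = [:a ^ p:]" by (simp add: poly_const_pow)
  have "of_nat p dvd [:a:] - [:a:] ^ p"
    using fermat unfolding const of_nat_poly by (simp add: dvd_diff_commute)
  moreover have "of_nat p dvd ?X ^ p * (f \<circ>\<^sub>p monom 1 p - f ^ p)"
    using pCons.IH by (rule dvd_mult)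
  moreover have "of_nat p dvd ([:a:] + ?X * f) ^ p - [:a:] ^ p - (?X * f) ^ p"
    by (rule prime_dvd_freshmans_dream[OF assms])
  \<comment> \<open>After expansion the p-th powers of \<open>[:a:]\<close> and of
    \<open>?X * f\<close> cancel, which leaves exactly the difference for
    \<open>pCons a f\<close>.\<close>
  ultimately have "of_nat p dvd ([:a:] - [:a:] ^ p + ?X ^ p * (f \<circ>\<^sub>p monom 1 p - f ^ p))
      - (([:a:] + ?X * f) ^ p - [:a:] ^ p - (?X * f) ^ p)"
    by (rule dvd_diff[OF dvd_add])
  also have "\<dots> = pCons a f \<circ>\<^sub>p monom 1 p - pCons a f ^ p"
  proof -
    have split: "[:a:] + ?X * f = pCons a f" by simp
    have power: "?X ^ p = monom 1 p" by (metis x_as_monom x_pow_n)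
    then have "(?X * f) ^ p = monom 1 p * f ^ p" by (simp only: power_mult_distrib)
    then show ?thesis
      unfolding split power by (simp add: pcompose_pCons algebra_simps)
  qed
  finally show ?case .
qed

section \<open>Integral minimal polynomials\<close>

text \<open>A nonzero integer polynomial of least degree vanishing at z has a primitive part that
  divides every other one, by pseudo-division and Gauss's lemma. Dividing the monic
  \<open>h\<close>, it has leading coefficient 1 or -1.\<close>

lemma algebraic_integer_int_min_poly:
  fixes z :: "'a :: field_char_0"
  assumes "lead_coeff h = 1" "ipoly h z = 0"
  obtains f where "lead_coeff f = 1" "ipoly f z = 0" "\<And>g. ipoly g z = 0 \<Longrightarrow> f dvd g"
proof -
  let ?R = "\<lambda>g. g \<noteq> 0 \<and> ipoly g z = 0"
  have "?R h" using assms by auto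
  then obtain g0 where g0: "?R g0" and min: "\<And>g. ?R g \<Longrightarrow> degree g0 \<le> degree g"
    using ex_has_least_nat[of ?R h degree] by blast
  define f0 where "f0 = primitive_part g0"
  have g0_eq: "g0 = smult (content g0) f0" by (simp add: f0_def)
  have "ipoly g0 z = of_int (content g0) * ipoly f0 z"
    by (subst g0_eq) (simp only: of_int_hom.map_poly_hom_smult poly_smult)
  then have f0: "f0 \<noteq> 0" "ipoly f0 z = 0" "content f0 = 1" "degree f0 = degree g0"
    using g0 by (auto simp: f0_def)
  have dvd: "f0 dvd g" if g: "ipoly g z = 0" for g
  proof (cases "g = 0")
    case False
    obtain q r where qr: "pseudo_divmod g f0 = (q, r)" by fastforce
    \<comment> \<open>Pseudo-division yields a multiple \<open>c\<close> of \<open>g\<close>. Since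
      \<open>f0\<close> is primitive, the content of the quotient is divisible by \<open>c\<close>,
      so \<open>c\<close> can be cancelled.\<close>
    define c where "c = lead_coeff f0 ^ (Suc (degree g) - degree f0)"
    have eq: "smult c g = f0 * q + r" and deg: "r = 0 \<or> degree r < degree f0"
      using pseudo_divmod[OF f0(1) qr] by (auto simp: c_def)
    have "ipoly (smult c g) z = ipoly (f0 * q + r) z" by (simp only: eq)
    then have "ipoly r z = 0"
      using g f0 by (simp add: of_int_hom.map_poly_hom_smult of_int_poly_hom.hom_add of_int_poly_hom.hom_mult)
    with min[of r] deg f0 have "r = 0" by force
    with eq have eq: "smult c g = f0 * q" by simp
    then have "content q = normalize c * content g"
      using f0(3) by (metis content_mult content_smult mult_1)
    then have "normalize c dvd content q" by (metis dvd_triv_left)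
    then have "[:c:] dvd q" by (simp only: const_poly_dvd_iff_dvd_content normalize_dvd_iff)
    then obtain q' where "q = smult c q'" by (auto simp: dvd_def)
    with eq have "smult c g = smult c (f0 * q')" by simp
    moreover have "c \<noteq> 0" using f0(1) by (simp add: c_def)
    ultimately show ?thesis by (metis dvd_triv_left smult_cancel)
  qed auto
  have "lead_coeff f0 dvd 1"
    using dvd[OF assms(2)] assms(1) by (metis dvd_def lead_coeff_mult)
  \<comment> \<open>The leading coefficient is its own inverse, so scaling by it makes
    \<open>f0\<close> monic and scaling twice changes nothing.\<close>
  then have unit: "lead_coeff f0 * lead_coeff f0 = 1"
    by (metis abs_mult_self_eq mult_1 zdvd1_eq)
  show ?thesis
  proof
    show "lead_coeff (smult (lead_coeff f0) f0) = 1" unfolding lead_coeff_smult by (rule unit)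
    show "ipoly (smult (lead_coeff f0) f0) z = 0"
      by (simp add: of_int_hom.map_poly_hom_smult f0)
    show "smult (lead_coeff f0) f0 dvd g" if "ipoly g z = 0" for g
    proof -
      have "smult (lead_coeff f0) f0 dvd smult (lead_coeff f0) g"
        using dvd[OF that] by (auto simp: dvd_def)
      then have "smult (lead_coeff f0) f0 dvd smult (lead_coeff f0) (smult (lead_coeff f0) g)"
        by (rule dvd_smult)
      then show ?thesis by (simp only: smult_smult unit smult_1_left)
    qed
  qed
qed

section \<open>Coprime powers of roots of unity as conjugates\<close>

lemma degree_monom_minus_one:
  "n > 0 \<Longrightarrow> degree (monom (1 :: 'a :: comm_ring_1) n - 1) = n"
  by (subst diff_conv_add_uminus, subst degree_add_eq_left) (simp_all add: degree_monom_eq)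

lemma monic_monom_minus_one:
  "n > 0 \<Longrightarrow> lead_coeff (monom (1 :: 'a :: comm_ring_1) n - 1) = 1"
  by (simp add: degree_monom_minus_one)

text \<open>Integers divisible by q in Z[z] are divisible by q in Z: after reducing \<open>G\<close>
  modulo the monic \<open>f\<close>, the difference q R - n has degree below that of
  \<open>f\<close>, hence is zero, and its constant coefficient shows the divisibility.\<close>

lemma dvd_of_ipoly_eq:
  fixes z :: "'a :: field_char_0"
  assumes "\<And>g. ipoly g z = 0 \<Longrightarrow> f dvd g" "lead_coeff f = 1" "degree f > 0"
    and "of_int q * ipoly G z = of_int n"
  shows "q dvd n"
proof -
  obtain Q R where QR: "pseudo_divmod G f = (Q, R)" by fastforce
  have f0: "f \<noteq> 0" using assms by auto
  have G: "G = f * Q + R" and deg: "R = 0 \<or> degree R < degree f"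
    using pseudo_divmod[OF f0 QR] assms(2) by auto
  have "ipoly (smult q G - [:n:]) z = 0"
    using assms(4) by (simp add: of_int_hom.map_poly_hom_smult of_int_hom.map_poly_pCons_hom of_int_poly_hom.hom_minus)
  then have "f dvd smult q G - [:n:]" by (rule assms(1))
  moreover have "smult q G - [:n:] = f * smult q Q + (smult q R - [:n:])"
    by (simp add: G smult_add_right)
  ultimately have "f dvd smult q R - [:n:]" by (metis dvd_add_triv_right_iff dvd_add_right_iff dvd_triv_left)
  moreover have "degree (smult q R - [:n:]) < degree f"
    using deg assms(3) by (intro degree_diff_less) auto
  ultimately have "smult q R - [:n:] = 0"
    using assms(2) by (metis dvd_imp_degree_le leD)
  then have "coeff (smult q R) 0 = coeff [:n:] 0" by simp
  then show ?thesis by (metis coeff_pCons_0 coeff_smult dvd_triv_left)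
qed

text \<open>If \<open>f\<close> did not vanish at \<open>w = z ^ q\<close>, then differentiating
  \<open>x ^ n - 1 = f x * h x\<close> at \<open>w\<close> would give \<open>n * w ^ (n - 1) = f w * h' w\<close>,
  and \<open>f w\<close> is \<open>q\<close> times an algebraic integer by the Frobenius congruence;
  this forces \<open>q\<close> to divide \<open>n\<close>.\<close>

lemma int_min_poly_root_unity_prime_power:
  fixes z :: "'a :: field_char_0"
  assumes z: "z ^ n = 1" and n: "n > 0"
    and f: "lead_coeff f = 1" "ipoly f z = 0" "\<And>g. ipoly g z = 0 \<Longrightarrow> f dvd g"
    and q: "prime q" "\<not> q dvd n"
  shows "ipoly f (z ^ q) = 0"
proof (rule ccontr)
  assume nz: "ipoly f (z ^ q) \<noteq> 0"
  define w where "w = z ^ q"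
  have w: "w ^ n = 1" by (simp add: w_def z flip: power_mult, metis mult.commute power_mult power_one z)
  have "ipoly (monom 1 n - 1 :: int poly) z = 0"
    by (simp add: of_int_poly_hom.hom_minus poly_monom z)
  then obtain h where h: "monom 1 n - 1 = f * h" using f(3) by (auto simp: dvd_def)
  have "ipoly f w * ipoly h w = ipoly (monom 1 n - 1 :: int poly) w"
    by (simp add: h of_int_poly_hom.hom_mult)
  also have "\<dots> = 0" by (simp add: of_int_poly_hom.hom_minus poly_monom w)
  finally have hw: "ipoly h w = 0" using nz by (simp add: w_def)
  have "ipoly (pderiv (monom 1 n - 1 :: int poly)) w = ipoly f w * ipoly (pderiv h) w"
    by (simp add: h pderiv_mult of_int_poly_hom.hom_mult of_int_poly_hom.hom_add hw)
  then have deriv: "of_nat n * w ^ (n - 1) = ipoly f w * ipoly (pderiv h) w"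
    by (simp add: pderiv_diff pderiv_monom poly_monom)
  obtain g where g: "f \<circ>\<^sub>p monom 1 q - f ^ q = of_nat q * g"
    using prime_dvd_poly_frobenius[OF q(1)] by (auto simp: dvd_def)
  have "ipoly (f \<circ>\<^sub>p monom 1 q - f ^ q) z = ipoly f w"
    using f(2) prime_gt_0_nat[OF q(1)]
    by (simp add: of_int_poly_hom.hom_minus of_int_poly_hom.hom_power
        of_int_hom.map_poly_pcompose poly_pcompose poly_monom w_def power_0_left)
  then have fw: "ipoly f w = of_nat q * ipoly g z"
    by (simp add: g of_int_poly_hom.hom_mult of_nat_poly of_int_hom.map_poly_hom_smult)
  \<comment> \<open>The factor \<open>monom 1 1\<close> supplies the extra w that turns n w^(n-1)
    into n w^n = n; composing with \<open>monom 1 q\<close> makes a value at w = z^q a value at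
    z.\<close>
  define G where "G = g * (pderiv h * monom 1 1) \<circ>\<^sub>p monom 1 q"
  have G: "ipoly G z = ipoly g z * ipoly (pderiv h) w * w"
    by (simp add: G_def of_int_poly_hom.hom_mult of_int_hom.map_poly_pcompose
        poly_pcompose poly_monom w_def pcompose_mult)
  have "of_int (int q) * ipoly G z = ipoly f w * ipoly (pderiv h) w * w"
    by (simp add: G fw)
  also have "\<dots> = of_int (int n)"
    using n w power_minus_mult[of n w] by (simp add: deriv[symmetric] mult.assoc)
  finally have "int q dvd int n"
  proof (rule dvd_of_ipoly_eq[rotated 3])
    show "degree f > 0"
    proof (rule ccontr)
      assume "\<not> degree f > 0"
      then obtain c where "f = [:c:]" by (auto elim: degree_eq_zeroE)
      with f(1,2) show False by simp
    qed
  qed (use f in auto)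
  with q show False by simp
qed

text \<open>This is the form in which irreducibility of the cyclotomic polynomials is used. The
  exponent is built up prime by prime: for w = z^k the integral minimal polynomial of w divides
  \<open>g\<close> and vanishes at w^q, as q does not divide n.\<close>

theorem int_poly_root_unity_coprime_power:
  fixes z :: "'a :: field_char_0"
  assumes n: "n > 0"
  shows "coprime k n \<Longrightarrow> k > 0 \<Longrightarrow> z ^ n = 1 \<Longrightarrow> ipoly g z = 0 \<Longrightarrow> ipoly g (z ^ k) = 0"
proof (induction k rule: prime_divisors_induct)
  case (factor q k)
  define w where "w = z ^ k"
  have "ipoly g w = 0"
    using factor by (auto simp: w_def)
  moreover have w: "w ^ n = 1"
    by (metis factor.prems(3) mult.commute power_mult power_one w_def)
  have "ipoly (monom 1 n - 1 :: int poly) w = 0"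
    by (simp add: of_int_poly_hom.hom_minus poly_monom w)
  moreover have "lead_coeff (monom 1 n - 1 :: int poly) = 1"
    using n by (rule monic_monom_minus_one)
  ultimately obtain f where f: "lead_coeff f = 1" "ipoly f w = 0" "\<And>g. ipoly g w = 0 \<Longrightarrow> f dvd g"
    using algebraic_integer_int_min_poly[of "monom 1 n - 1" w] by blast
  have "\<not> q dvd n"
    using factor.prems(1) \<open>prime q\<close> by (metis coprime_common_divisor coprime_mult_left_iff dvd_refl not_prime_unit)
  then have "ipoly f (w ^ q) = 0"
    using int_min_poly_root_unity_prime_power[OF w n f] factor by blast
  moreover have "f dvd g" using f(3) \<open>ipoly g w = 0\<close> .
  ultimately have "ipoly g (w ^ q) = 0" by (auto simp: dvd_def of_int_poly_hom.hom_mult)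
  then show ?case by (simp add: w_def mult.commute flip: power_mult)
qed auto

section \<open>Monic square roots and monic quotients of polynomials\<close>

text \<open>Let k be the largest index of an irrational coefficient and m the degree. In the square,
  coefficient m + k is twice coefficient k plus rational terms, a contradiction.\<close>

lemma monic_rational_square_imp_rational:
  fixes p :: "real poly"
  assumes monic: "lead_coeff p = 1" and sq: "\<And>i. coeff (p\<^sup>2) i \<in> \<rat>"
  shows "coeff p i \<in> \<rat>"
proof (rule ccontr)
  assume i: "coeff p i \<notin> \<rat>"
  define m where "m = degree p"
  define S where "S = {k. coeff p k \<notin> \<rat>}"
  have S: "S \<subseteq> {..<m}"
  proof
    fix k assume k: "k \<in> S"
    then have "coeff p k \<noteq> 0" "k \<noteq> m" using monic by (auto simp: S_def m_def)
    then show "k \<in> {..<m}" using le_degree[of p k] by (simp add: m_def)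
  qed
  then have fin: "finite S" by (rule finite_subset) simp
  define k where "k = Max S"
  have "k \<in> S" using Max_in[OF fin] i by (auto simp: k_def S_def)
  then have km: "k < m" and k: "coeff p k \<notin> \<rat>" using S by (auto simp: S_def)
  have above: "coeff p j \<in> \<rat>" if "j > k" for j
    using Max_ge[OF fin, of j] that by (auto simp: k_def S_def not_le)
  let ?t = "\<lambda>j. coeff p j * coeff p (m + k - j)"
  have "coeff (p\<^sup>2) (m + k) = sum ?t {..m + k}"
    by (simp add: power2_eq_square coeff_mult)
  also have "{..m + k} = insert k (insert m ({..m + k} - {k, m}))" by auto
  \<comment> \<open>The positions k and m both contribute \<open>coeff p k\<close>, because the
    leading coefficient is 1.\<close>
  also have "sum ?t \<dots> = 2 * coeff p k + sum ?t ({..m + k} - {k, m})"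
    using km monic by (simp add: m_def)
  finally have "coeff p k = (coeff (p\<^sup>2) (m + k) - sum ?t ({..m + k} - {k, m})) / 2"
    by simp
  also have "\<dots> \<in> \<rat>"
  proof (intro Rats_divide Rats_diff sq Rats_sum)
    fix j assume j: "j \<in> {..m + k} - {k, m}"
    \<comment> \<open>Outside the range from k to m one of the two indices exceeds the degree;
      strictly inside it both j and m + k - j exceed k.\<close>
    consider "j < k" | "j > m" | "k < j" "j < m" using j by fastforce
    then show "?t j \<in> \<rat>"
    proof cases
      case 1
      then show ?thesis using coeff_eq_0[of p "m + k - j"] by (simp add: m_def)
    next
      case 2
      then show ?thesis using coeff_eq_0[of p j] by (simp add: m_def)
    next
      case 3
      then show ?thesis by (intro Rats_mult above) auto
    qed
  qed auto
  finally show False using k by simp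
qed

text \<open>Division by a monic polynomial stays within the integers. Over the field, b (c - q) = r
  with r of smaller degree than b, so c = q.\<close>

lemma of_int_poly_monic_quotient:
  fixes c :: "'a :: field_char_0 poly"
  assumes eq: "map_poly of_int a = map_poly of_int b * c" and monic: "lead_coeff b = 1"
  obtains c' where "c = map_poly of_int c'"
proof -
  obtain q r where qr: "pseudo_divmod a b = (q, r)" by fastforce
  have b0: "b \<noteq> 0" using monic by auto
  have a: "a = b * q + r" and deg: "r = 0 \<or> degree r < degree b"
    using pseudo_divmod[OF b0 qr] monic by auto
  let ?h = "map_poly of_int :: int poly \<Rightarrow> 'a poly"
  have r: "?h b * (c - ?h q) = ?h r"
    using eq by (simp add: a of_int_poly_hom.hom_add of_int_poly_hom.hom_mult algebra_simps)
  have "c - ?h q = 0"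
  proof (rule ccontr)
    assume nz: "c - ?h q \<noteq> 0"
    moreover have "?h b \<noteq> 0" using b0 by simp
    ultimately have "degree (?h r) \<ge> degree b" "?h r \<noteq> 0"
      unfolding r[symmetric] by (simp_all add: degree_mult_eq)
    with deg show False by auto
  qed
  then show ?thesis using that[of q] by simp
qed

section \<open>Products over roots of unity and over totatives\<close>

lemma prod_roots_unity:
  fixes x :: complex
  assumes "n > 0"
  shows "(\<Prod>k<n. x - cis (2 * pi * real k / real n)) = x ^ n - 1"
proof -
  have bij: "bij_betw (\<lambda>k. cis (2 * pi * real k / real n)) {..<n} {z. z ^ n = 1}"
    by (rule bij_betw_roots_unity[OF assms])
  let ?R = "{z :: complex. z ^ n = 1}"
  let ?P = "\<Prod>z\<in>?R. [:- z, 1:]"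
  have fin: "finite ?R" using assms by (intro finite_roots_unity) simp
  have deg: "degree ?P = n"
    using card_roots_unity_eq[OF assms] by (simp add: degree_prod_eq_sum_degree)
  have "lead_coeff ?P = 1" by (simp add: lead_coeff_prod)
  then have monic: "coeff ?P n = 1" by (simp only: deg)
  have "?P = monom 1 n - 1"
  proof (rule poly_eqI_degree_lead_coeff[where n = n and A = ?R])
    show "coeff ?P n = coeff (monom 1 n - 1) n"
      using assms monic by simp
    show "poly ?P z = poly (monom 1 n - 1) z" if "z \<in> ?R" for z
      using that fin by (auto simp: poly_prod poly_monom)
    show "degree ?P \<le> n" by (simp only: deg order_refl)
  qed (use assms in \<open>simp_all add: degree_monom_minus_one card_roots_unity_eq\<close>)
  then have "poly ?P x = x ^ n - 1" by (simp add: poly_monom)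
  moreover have "poly ?P x = (\<Prod>z\<in>?R. x - z)" by (simp add: poly_prod)
  ultimately show ?thesis using prod.reindex_bij_betw[OF bij, of "\<lambda>z. x - z"] by simp
qed

text \<open>The assumption on \<open>F\<close> says that it depends only on the fraction k / m. The
  k with gcd d correspond to d times the totatives of n / d, so reducing fractions sorts the product
  by denominators.\<close>

lemma prod_totatives:
  fixes F :: "nat \<Rightarrow> nat \<Rightarrow> 'a :: comm_monoid_mult"
  assumes n: "n > 0" and F: "\<And>d m k. d > 0 \<Longrightarrow> F (m * d) (k * d) = F m k"
  shows "(\<Prod>k\<in>{0<..n}. F n k) = (\<Prod>d | d dvd n. \<Prod>k\<in>totatives d. F d k)"
proof -
  define A where "A = (\<lambda>d. {k\<in>{0<..n}. gcd k n = d})"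
  have "{0<..n} = (\<Union>d\<in>{d. d dvd n}. A d)" by (auto simp: A_def)
  then have "(\<Prod>k\<in>{0<..n}. F n k) = (\<Prod>k\<in>(\<Union>d\<in>{d. d dvd n}. A d). F n k)" by simp
  also have "\<dots> = (\<Prod>d | d dvd n. \<Prod>k\<in>A d. F n k)"
    using n by (intro prod.UNION_disjoint) (auto simp: A_def)
  also have "\<dots> = (\<Prod>d | d dvd n. \<Prod>k\<in>totatives (n div d). F (n div d) k)"
  proof (rule prod.cong[OF refl])
    fix d assume "d \<in> {d. d dvd n}"
    then have d: "d dvd n" "d > 0" using n by (auto intro: dvd_pos_nat)
    have "(\<Prod>k\<in>totatives (n div d). F n (k * d)) = (\<Prod>k\<in>A d. F n k)"
      unfolding A_def by (rule prod.reindex_bij_betw[OF bij_betw_totatives_gcd_eq[OF d(1) n], of "F n"])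
    moreover have "F n (k * d) = F (n div d) k" for k
      using F[of d "n div d" k] d by simp
    ultimately show "(\<Prod>k\<in>A d. F n k) = (\<Prod>k\<in>totatives (n div d). F (n div d) k)" by simp
  qed
  also have "\<dots> = (\<Prod>d | d dvd n. \<Prod>k\<in>totatives d. F d k)"
    \<comment> \<open>The involution d -> n / d on the divisors of n.\<close>
    by (rule prod.reindex_bij_witness[of _ "(div) n" "(div) n"]) (use n in \<open>auto elim: dvdE\<close>)
  finally show ?thesis .
qed

section \<open>Factorization of \<open>Z_poly\<close> over the reals\<close>

definition spread_root :: "nat \<Rightarrow> nat \<Rightarrow> real" where
  "spread_root n k = 4 * (sin (pi * real k / real n))\<^sup>2"

lemma spread_root_eq_cos: "spread_root n k = 2 - 2 * cos (2 * pi * real k / real n)"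
proof -
  have "cos (2 * (pi * real k / real n)) = 1 - 2 * (sin (pi * real k / real n))\<^sup>2"
    by (simp only: cos_double_sin)
  then show ?thesis by (simp add: spread_root_def mult_ac)
qed

lemma of_real_spread_root:
  fixes n k :: nat
  defines "w \<equiv> cis (2 * pi * real k / real n)"
  shows "of_real (spread_root n k) = 2 - w - inverse w"
  by (simp add: w_def spread_root_eq_cos cis_inverse complex_eq_iff)

text \<open>The sequence z^n + z^(-n) obeys the recurrence of \<open>l_poly\<close>: the cross terms
  of the product collapse because z times its inverse is 1.\<close>

lemma l_poly_eval:
  fixes z :: "'a :: field_char_0"
  assumes "z \<noteq> 0"
  shows "ipoly (l_poly n) (z + inverse z) = z ^ n + inverse z ^ n"
proof (induction n rule: l_poly.induct)
  case 1
  show ?case by (simp add: of_int_hom.map_poly_pCons_hom)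
next
  case 2
  show ?case by (simp add: of_int_hom.map_poly_pCons_hom)
next
  case (3 n)
  define y where "y = inverse z"
  have zy: "z * y = 1" using assms by (simp add: y_def)
  have "ipoly (l_poly (Suc (Suc n))) (z + y)
      = (z + y) * (z ^ Suc n + y ^ Suc n) - (z ^ n + y ^ n)"
    using 3 by (simp add: of_int_poly_hom.hom_minus of_int_poly_hom.hom_mult
        of_int_hom.map_poly_pCons_hom flip: y_def)
  also have "\<dots> = z ^ Suc (Suc n) + y ^ Suc (Suc n) + (z * y) * (y ^ n + z ^ n) - (z ^ n + y ^ n)"
    by (simp add: algebra_simps)
  finally show ?case by (simp add: zy flip: y_def)
qed

lemma Z_poly_eval:
  fixes z :: "'a :: field_char_0"
  assumes "z \<noteq> 0"
  shows "ipoly (Z_poly n) (2 - z - inverse z) = 2 - z ^ n - inverse z ^ n"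
proof -
  have two: "(2 :: int poly) = [:2:]" by (simp add: numeral_poly)
  show ?thesis
    unfolding Z_poly_def two
    using l_poly_eval[OF assms, of n]
    by (simp add: of_int_poly_hom.hom_minus of_int_hom.map_poly_pcompose poly_pcompose
        of_int_hom.map_poly_pCons_hom algebra_simps)
qed

text \<open>It suffices to compare values at the infinitely many x \<le> 0, where x = 2 - z - 1/z
  has a real solution z > 0.\<close>

lemma Z_poly_eq_prod:
  assumes n: "n > 0"
  shows "map_poly of_int ((- 1) ^ (n - 1) * Z_poly n) = (\<Prod>k\<in>{0<..n}. [:- spread_root n k, 1:])"
    (is "?P = ?Q")
proof -
  have "poly (?P - ?Q) x = 0" if x: "x \<le> 0" for x
  proof -
    \<comment> \<open>\<open>z\<close> is the larger root of z^2 - (2 - x) z + 1; for x \<le> 0 the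
      discriminant \<open>s\<close>^2 is nonnegative.\<close>
    define s where "s = sqrt ((2 - x)\<^sup>2 - 4)"
    define z where "z = (2 - x + s) / 2"
    have "2\<^sup>2 \<le> (2 - x)\<^sup>2" using x by (intro power_mono) auto
    then have s: "s \<ge> 0" "s\<^sup>2 = (2 - x)\<^sup>2 - 4" by (auto simp: s_def)
    then have z: "z > 0" using x by (simp add: z_def)
    have "z\<^sup>2 + 1 = (2 - x) * z"
      using s(2) by (simp add: z_def power2_eq_square field_simps)
    then have x_eq: "x = 2 - z - inverse z" 
      using z by (simp add: field_simps power2_eq_square)
    let ?c = "\<lambda>k. cis (2 * pi * real k / real n)"
    \<comment> \<open>As z is real, the conjugate roots of unity combine into a squared modulus, so
      the whole product becomes |z^n - 1|^2 times (-1/z)^n.\<close>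
    have factor: "x - spread_root n k = (cmod (of_real z - ?c k))\<^sup>2 * (- inverse z)" for k
    proof -
      have "(cmod (of_real z - ?c k))\<^sup>2 = z\<^sup>2 - 2 * z * cos (2 * pi * real k / real n) + 1"
        by (simp add: cmod_power2 power2_diff algebra_simps)
      moreover have "x - spread_root n k
          = (z\<^sup>2 - 2 * z * cos (2 * pi * real k / real n) + 1) * (- inverse z)"
        using z by (simp add: x_eq spread_root_eq_cos field_simps power2_eq_square)
      ultimately show ?thesis by simp
    qed
    \<comment> \<open>Both values are 0, so the index range 1..n can be exchanged for 0..n-1, the
      range of the roots-of-unity product.\<close>
    have ends: "spread_root n n = spread_root n 0" using n by (simp add: spread_root_def)
    have "{0<..n} = insert n {1..<n}" "{..<n} = insert 0 {1..<n}" using n by auto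
    then have "poly ?Q x = (\<Prod>k<n. x - spread_root n k)"
      by (simp add: poly_prod ends left_diff_distrib)
    also have "\<dots> = (cmod (\<Prod>k<n. of_real z - ?c k))\<^sup>2 * (- inverse z) ^ n"
      unfolding factor prod.distrib prod_norm[symmetric] prod_power_distrib by simp
    also have "(\<Prod>k<n. of_real z - ?c k) = of_real (z ^ n - 1)"
      by (simp add: prod_roots_unity[OF n])
    also have "(cmod \<dots>)\<^sup>2 = (z ^ n - 1)\<^sup>2"
      by (simp only: norm_of_real power2_abs)
    also have "(z ^ n - 1)\<^sup>2 * (- inverse z) ^ n = (- 1) ^ n * (z ^ n + inverse z ^ n - 2)"
    proof -
      have "(- inverse z) ^ n = (- 1) ^ n * inverse (z ^ n)"
        by (subst power_minus) (simp add: power_inverse)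
      moreover have "(y - 1)\<^sup>2 * inverse y = y + inverse y - 2" if "y > 0" for y :: real
        using that by (simp add: power2_eq_square field_simps)
      ultimately show ?thesis using z by (simp add: power_inverse)
    qed
    also have "\<dots> = (- 1) ^ (n - 1) * (2 - z ^ n - inverse z ^ n)"
      using n by (cases n) (simp_all add: algebra_simps)
    also have "\<dots> = poly ?P x"
      using z by (simp add: x_eq Z_poly_eval of_int_poly_hom.hom_mult of_int_poly_hom.hom_power of_int_poly_hom.hom_uminus)
    finally show ?thesis by simp
  qed
  then have "{..0} \<subseteq> {x. poly (?P - ?Q) x = 0}" by auto
  then have "infinite {x. poly (?P - ?Q) x = 0}"
    using infinite_Iic infinite_super by blast
  then show ?thesis using poly_roots_finite[of "?P - ?Q"] by auto
qed

section \<open>Conjugates of 4 sin^2 (pi / n)\<close>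

text \<open>Clears denominators in the substitution x = 2 - w - 1/w, so that facts about integer
  polynomials at roots of unity apply to \<open>g\<close>.\<close>

lemma ipoly_joukowski:
  obtains D G where "\<And>w :: 'a :: field_char_0. w \<noteq> 0 \<Longrightarrow> ipoly G w = w ^ D * ipoly g (2 - w - inverse w)"
proof -
  have "\<exists>D G. \<forall>w :: 'a. w \<noteq> 0 \<longrightarrow> ipoly G w = w ^ D * ipoly g (2 - w - inverse w)"
  proof (induction g)
    case 0
    show ?case by (intro exI[of _ 0]) simp
  next
    case (pCons a g)
    then obtain D G where G: "\<And>w :: 'a. w \<noteq> 0 \<Longrightarrow> ipoly G w = w ^ D * ipoly g (2 - w - inverse w)"
      by blast
    \<comment> \<open>\<open>Q\<close> is w (2 - w - 1/w) written as a polynomial in w.\<close>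
    define Q where "Q = [:-1, 2, -1 :: int:]"
    have "ipoly (monom a (Suc D) + Q * G) w
        = w ^ Suc D * ipoly (pCons a g) (2 - w - inverse w)" if w: "w \<noteq> 0" for w :: 'a
    proof -
      have "ipoly Q w = w * (2 - w - inverse w)"
        using w by (simp add: Q_def of_int_hom.map_poly_pCons_hom algebra_simps)
      then have "ipoly (monom a (Suc D) + Q * G) w
          = of_int a * w ^ Suc D + w * (2 - w - inverse w) * (w ^ D * ipoly g (2 - w - inverse w))"
        by (simp only: of_int_poly_hom.hom_add of_int_poly_hom.hom_mult
            of_int_hom.map_poly_hom_monom poly_add poly_mult poly_monom G[OF w])
      also have "\<dots> = w ^ Suc D * (of_int a + (2 - w - inverse w) * ipoly g (2 - w - inverse w))"
        by (simp only: distrib_left power_Suc mult_ac)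
      finally show ?thesis by (simp only: of_int_hom.map_poly_pCons_hom poly_pCons)
    qed
    then show ?case by blast
  qed
  then show ?thesis using that by blast
qed

text \<open>Since w^D never vanishes, zeros of \<open>g\<close> at spread roots match zeros of
  \<open>G\<close> at roots of unity, and there z -> z^k moves index 1 to index k.\<close>

lemma ipoly_spread_root_conjugate:
  assumes "n > 0" "coprime k n" "k > 0" "ipoly g (spread_root n 1) = 0"
  shows "ipoly g (spread_root n k) = 0"
proof -
  obtain D G where G: "\<And>w :: complex. w \<noteq> 0 \<Longrightarrow> ipoly G w = w ^ D * ipoly g (2 - w - inverse w)"
    using ipoly_joukowski[of g] by blast
  have of_real: "ipoly g (of_real x) = (of_real (ipoly g x) :: complex)" for x
    by (induction g) (simp_all add: of_int_hom.map_poly_pCons_hom)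
  have eval: "ipoly G (cis (2 * pi * real j / real n)) = 0 \<longleftrightarrow> ipoly g (spread_root n j) = 0" for j
    unfolding G[OF cis_neq_zero] of_real_spread_root[symmetric] of_real by simp
  define z where "z = cis (2 * pi * real 1 / real n)"
  have power: "z ^ j = cis (2 * pi * real j / real n)" for j
    unfolding z_def DeMoivre by (simp add: mult_ac)
  have "ipoly G z = 0" unfolding z_def eval by (rule assms(4))
  moreover have "z ^ n = 1" using assms(1) by (simp add: power)
  ultimately have "ipoly G (z ^ k) = 0"
    using int_poly_root_unity_coprime_power assms by blast
  then show ?thesis by (simp only: power eval)
qed

section \<open>Integral factors and their square roots\<close>

definition spread_cyclotomic :: "nat \<Rightarrow> real poly" where
  "spread_cyclotomic n = (\<Prod>k\<in>totatives n. [:- spread_root n k, 1:])"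

text \<open>Takes one index from each pair k, n - k. For n \<ge> 3 this turns out to be the minimal
  polynomial of \<open>spread_root n 1\<close>.\<close>

definition spread_half :: "nat \<Rightarrow> real poly" where
  "spread_half n = (\<Prod>k | k \<in> totatives n \<and> 2 * k < n. [:- spread_root n k, 1:])"

lemma lead_coeff_spread_cyclotomic: "lead_coeff (spread_cyclotomic n) = 1"
  by (simp add: spread_cyclotomic_def lead_coeff_prod)

lemma degree_spread_cyclotomic: "degree (spread_cyclotomic n) = totient n"
  by (simp add: spread_cyclotomic_def degree_prod_eq_sum_degree totient_def)

lemma Z_poly_eq_prod_spread_cyclotomic:
  assumes "n > 0"
  shows "map_poly of_int ((- 1) ^ (n - 1) * Z_poly n) = (\<Prod>d | d dvd n. spread_cyclotomic d)"
  unfolding Z_poly_eq_prod[OF assms] spread_cyclotomic_def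
  by (rule prod_totatives[OF assms]) (simp add: spread_root_def)

lemma spread_cyclotomic_integral:
  assumes "n > 0"
  shows "\<exists>f. map_poly of_int f = spread_cyclotomic n"
  using assms
proof (induction n rule: less_induct)
  case (less n)
  let ?D = "{d. d dvd n} - {n}"
  have "\<exists>f. map_poly of_int f = spread_cyclotomic d" if "d \<in> ?D" for d
  proof (rule less.IH)
    show "d < n" using that less.prems by (auto dest: dvd_imp_le)
    show "d > 0" using that less.prems by (auto intro: dvd_pos_nat)
  qed
  then obtain f where f: "\<And>d. d \<in> ?D \<Longrightarrow> map_poly of_int (f d) = spread_cyclotomic d"
    by metis
  define b where "b = (\<Prod>d\<in>?D. f d)"
  have b: "map_poly of_int b = (\<Prod>d\<in>?D. spread_cyclotomic d)"
    by (simp add: b_def of_int_poly_hom.hom_prod f)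
  have "lead_coeff (map_poly of_int b :: real poly) = 1"
    unfolding b by (simp add: lead_coeff_prod lead_coeff_spread_cyclotomic)
  then have monic: "lead_coeff b = 1" by simp
  have "finite {d. d dvd n}" using less.prems by simp
  then have "(\<Prod>d | d dvd n. spread_cyclotomic d) = map_poly of_int b * spread_cyclotomic n"
    unfolding b by (subst prod.remove[of _ n]) (simp_all add: mult.commute)
  with of_int_poly_monic_quotient[OF _ monic] show ?case
    using Z_poly_eq_prod_spread_cyclotomic[OF less.prems] by metis
qed

lemma spread_cyclotomic_eq_square:
  assumes n: "n \<ge> 3"
  shows "spread_cyclotomic n = (spread_half n)\<^sup>2"
proof -
  let ?L = "{k. k \<in> totatives n \<and> 2 * k < n}" and ?R = "{k. k \<in> totatives n \<and> n < 2 * k}"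
  let ?F = "\<lambda>k. [:- spread_root n k, 1:]"
  \<comment> \<open>No totative is fixed by k -> n - k: it would divide n, hence equal 1 and force n
    = 2.\<close>
  have "2 * k \<noteq> n" if "k \<in> totatives n" for k
  proof
    assume "2 * k = n"
    then have "k dvd n" by (metis dvd_triv_right)
    with that have "k = 1" by (auto simp: in_totatives_iff intro: coprime_common_divisor_nat)
    with \<open>2 * k = n\<close> n show False by simp
  qed
  then have split: "totatives n = ?L \<union> ?R" by (auto simp: neq_iff)
  have fin: "finite ?L" "finite ?R" by (auto intro: finite_subset[OF _ finite_totatives])
  have symm: "n - k \<in> totatives n \<and> spread_root n (n - k) = spread_root n k" if "k \<in> totatives n" for k
  proof -
    have k: "k < n" "coprime k n" using that n by (auto simp: totatives_less in_totatives_iff)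
    have "pi * real (n - k) / real n = pi - pi * real k / real n"
      using k n by (simp add: field_simps of_nat_diff)
    moreover have "coprime (n - k) n"
      using k by (metis coprime_commute coprime_diff_one_left_nat diff_diff_cancel gcd_diff2_nat coprime_iff_gcd_eq_1 less_imp_le)
    ultimately show ?thesis using k by (simp add: spread_root_def in_totatives_iff)
  qed
  have "prod ?F ?R = prod ?F ?L"
  proof (rule prod.reindex_bij_witness[of _ "\<lambda>k. n - k" "\<lambda>k. n - k"])
    fix k assume "k \<in> ?R"
    then have "k \<in> totatives n" "n < 2 * k" "k \<le> n" by (auto simp: in_totatives_iff)
    then show "n - (n - k) = k" "n - k \<in> ?L" "?F (n - k) = ?F k" using symm[of k] by auto
  next
    fix k assume "k \<in> ?L"
    then have "k \<in> totatives n" "2 * k < n" by auto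
    then show "n - (n - k) = k" "n - k \<in> ?R" using symm[of k] by auto
  qed
  moreover have "spread_cyclotomic n = prod ?F ?L * prod ?F ?R"
    unfolding spread_cyclotomic_def by (subst split, rule prod.union_disjoint) (use fin in auto)
  ultimately show ?thesis by (simp add: spread_half_def power2_eq_square)
qed

section \<open>Minimal polynomial of 4 sin^2 (pi / n)\<close>

lemma sin_square_inj:
  assumes x: "0 \<le> x" "x \<le> pi / 2" and y: "0 \<le> y" "y \<le> pi / 2"
    and eq: "(sin x)\<^sup>2 = (sin y)\<^sup>2"
  shows "x = y"
proof (rule sin_inj_pi)
  show "sin x = sin y"
    using eq by (rule power2_eq_imp_eq) (use x y pi_gt_zero in \<open>auto intro!: sin_ge_zero\<close>)
qed (use x y pi_gt_zero in linarith)+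

text \<open>The angles stay in [0, pi/2], where sin^2 is injective. Hence the roots of
  \<open>spread_half\<close> are distinct and can be counted.\<close>

lemma inj_on_spread_root: "inj_on (spread_root n) {k. 2 * k \<le> n}"
proof (rule inj_onI)
  fix j k assume jk: "j \<in> {k. 2 * k \<le> n}" "k \<in> {k. 2 * k \<le> n}" "spread_root n j = spread_root n k"
  show "j = k"
  proof (cases "n = 0")
    case False
    have range: "0 \<le> pi * real i / real n" "pi * real i / real n \<le> pi / 2" if "2 * i \<le> n" for i
      using that False by (simp_all add: field_simps flip: of_nat_le_iff[where 'a = real])
    have le: "2 * j \<le> n" "2 * k \<le> n"
      and eq: "(sin (pi * real j / real n))\<^sup>2 = (sin (pi * real k / real n))\<^sup>2"
      using jk by (simp_all add: spread_root_def)
    have "pi * real j / real n = pi * real k / real n"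
      by (rule sin_square_inj[OF range[OF le(1)] range[OF le(2)] eq])
    then have "pi * real j = pi * real k" using False by (metis divide_cancel_right of_nat_eq_0_iff)
    then show ?thesis by simp
  qed (use jk in auto)
qed

lemma rat_poly_clear_denominators:
  obtains c :: int and Q where "c \<noteq> 0" "smult (of_int c) q = (map_poly of_int Q :: rat poly)"
proof -
  have "\<exists>c Q. c \<noteq> 0 \<and> smult (of_int c) q = (map_poly of_int Q :: rat poly)"
  proof (induction q)
    case 0
    show ?case by (intro exI[of _ 1] exI[of _ 0]) simp
  next
    case (pCons a q)
    then obtain c Q where c: "c \<noteq> 0" and Q: "smult (of_int c) q = (map_poly of_int Q :: rat poly)"
      by blast
    obtain x y where xy: "a = of_int x / of_int y" "y \<noteq> 0"
      by (metis Rat_cases Fract_of_int_quotient less_irrefl quotient_of_div)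
    have "smult (of_int (c * y)) (pCons a q) = map_poly of_int (pCons (c * x) (smult y Q))"
      using xy by (simp add: of_int_hom.map_poly_pCons_hom of_int_hom.map_poly_hom_smult mult.commute flip: Q)
    with c xy show ?case by (metis mult_eq_0_iff)
  qed
  then show ?thesis using that by blast
qed

lemma min_poly_rat_eqI: "is_min_poly_rat a p \<Longrightarrow> min_poly_rat a = p"
  unfolding min_poly_rat_def by (blast intro: is_min_poly_rat_unique)

text \<open>Settles n = 1 and n = 2, where 4 sin^2 (pi / n) is 0 and 4.\<close>

lemma min_poly_rat_of_rat: "min_poly_rat (of_rat r) = [:- r, 1:]"
proof (rule min_poly_rat_eqI, unfold is_min_poly_rat_def, intro conjI allI impI)
  show "poly (map_poly of_rat [:- r, 1:]) (of_rat r :: real) = 0"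
    by (simp add: map_poly_pCons of_rat_minus)
  fix q assume q: "q \<noteq> 0 \<and> poly (map_poly of_rat q) (of_rat r :: real) = 0"
  have "degree q \<noteq> 0"
  proof
    assume "degree q = 0"
    then obtain c where "q = [:c:]" by (auto elim: degree_eq_zeroE)
    with q show False by (simp add: map_poly_pCons)
  qed
  then show "degree [:- r, 1:] \<le> degree q" by simp
qed simp

lemma min_poly_rat_spread_root:
  assumes n: "n \<ge> 3"
  shows "map_poly of_rat (min_poly_rat (spread_root n 1)) = spread_half n"
proof -
  let ?L = "{k. k \<in> totatives n \<and> 2 * k < n}"
  have fin: "finite ?L" by (auto intro: finite_subset[OF _ finite_totatives])
  have monic: "lead_coeff (spread_half n) = 1"
    by (simp add: spread_half_def lead_coeff_prod)
  have deg: "degree (spread_half n) = card ?L"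
    by (simp add: spread_half_def degree_prod_eq_sum_degree)
  have "coeff ((spread_half n)\<^sup>2) i \<in> \<rat>" for i
  proof -
    obtain f where "map_poly of_int f = (spread_half n)\<^sup>2"
      using spread_cyclotomic_integral[of n] n by (auto simp: spread_cyclotomic_eq_square)
    then have "coeff ((spread_half n)\<^sup>2) i = of_int (coeff f i)"
      by (metis of_int_hom.coeff_map_poly_hom)
    then show ?thesis by simp
  qed
  then have rat: "coeff (spread_half n) i \<in> \<rat>" for i
    using monic_rational_square_imp_rational[OF monic] by blast
  \<comment> \<open>Pulls the coefficients back to the rationals; \<open>inv0\<close> keeps zero
    coefficients zero, as \<open>coeff_map_poly\<close> requires.\<close>
  define p where "p = map_poly (inv_into UNIV real_of_rat) (spread_half n)"
  have inv0: "inv_into UNIV real_of_rat 0 = 0" by (rule inv_f_eq) (auto intro: injI)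
  have p: "map_poly of_rat p = spread_half n"
    by (rule poly_eqI) (use rat in \<open>simp add: p_def coeff_map_poly inv0 f_inv_into_f Rats_def\<close>)
  have "is_min_poly_rat (spread_root n 1) p"
    unfolding is_min_poly_rat_def
  proof (intro conjI allI impI)
    have "real_of_rat (lead_coeff p) = 1"
      using monic by (simp flip: p)
    then show "lead_coeff p = 1" by simp
    have "1 \<in> ?L" using n by simp
    then show "poly (map_poly of_rat p) (spread_root n 1) = 0"
      unfolding p spread_half_def poly_prod using fin by (intro prod_zero) auto
    fix q assume q: "q \<noteq> 0 \<and> poly (map_poly of_rat q) (spread_root n 1) = 0"
    obtain c Q where c: "c \<noteq> 0" and Q: "smult (of_int c) q = (map_poly of_int Q :: rat poly)"
      by (rule rat_poly_clear_denominators)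
    have "map_poly of_int Q = (map_poly of_rat (map_poly of_int Q) :: real poly)"
      by (rule poly_eqI) (simp add: coeff_map_poly)
    also have "\<dots> = smult (of_int c) (map_poly of_rat q)"
      by (simp add: of_rat_hom.map_poly_hom_smult flip: Q)
    finally have "ipoly Q (spread_root n 1) = of_int c * poly (map_poly of_rat q) (spread_root n 1)"
      by (simp only: poly_smult)
    then have "ipoly Q (spread_root n 1) = 0"
      by (simp only: q[THEN conjunct2] mult_zero_right)
    then have roots: "ipoly Q (spread_root n k) = 0" if "k \<in> totatives n" for k
      using that n ipoly_spread_root_conjugate[of n k Q] by (simp add: in_totatives_iff)
    have "Q \<noteq> 0" using c q Q by auto
    \<comment> \<open>\<open>Q\<close> vanishes at all conjugates, and those with 2 k < n are
      already as many distinct roots as the degree of \<open>p\<close>.\<close>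
    have "card ?L = card (spread_root n ` ?L)"
      by (rule card_image[symmetric]) (rule inj_on_subset[OF inj_on_spread_root], auto)
    also have "\<dots> \<le> card {x. ipoly Q x = (0 :: real)}"
      using roots \<open>Q \<noteq> 0\<close> by (intro card_mono poly_roots_finite) auto
    also have "\<dots> \<le> degree Q"
      using card_poly_roots_bound[of "map_poly of_int Q :: real poly"] \<open>Q \<noteq> 0\<close> by simp
    also have "\<dots> = degree (smult (of_int c) q)" by (simp only: Q of_int_hom.degree_map_poly_hom)
    also have "\<dots> = degree q" using c by simp
    finally show "degree p \<le> degree q"
      by (metis deg p of_rat_hom.degree_map_poly_hom)
  qed
  then show ?thesis using p min_poly_rat_eqI by metis
qed

section \<open>The sequence of integral factors\<close>

theorem theorem2:
  shows "\<exists>\<Phi> :: nat \<Rightarrow> int poly.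
    (\<forall>n\<ge>1. lead_coeff (\<Phi> n) = 1) \<and>
    (\<forall>n\<ge>1. (- 1) ^ (n - 1) * Z_poly n = (\<Prod>d | d dvd n. \<Phi> d) \<and>
            (\<forall>d. d dvd n \<longrightarrow> degree (\<Phi> d) = totient d)) \<and>
    \<Phi> 1 = [:0, 1:] \<and> min_poly_rat (4 * (sin (pi / real 1))\<^sup>2) = [:0, 1:] \<and>
    \<Phi> 2 = [:- 4, 1:] \<and> min_poly_rat (4 * (sin (pi / real 2))\<^sup>2) = [:- 4, 1:] \<and>
    (\<forall>n\<ge>3. map_poly of_int (\<Phi> n) = (min_poly_rat (4 * (sin (pi / real n))\<^sup>2))\<^sup>2)"
proof -
  define \<Phi> where "\<Phi> n = (SOME f. map_poly of_int f = spread_cyclotomic n)" for n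
  have \<Phi>: "map_poly of_int (\<Phi> n) = spread_cyclotomic n" if "n > 0" for n
    unfolding \<Phi>_def using spread_cyclotomic_integral[OF that] by (rule someI_ex)
  show ?thesis
  proof (intro exI[of _ \<Phi>] conjI allI impI)
    fix n :: nat assume n: "n \<ge> 1"
    have "lead_coeff (map_poly of_int (\<Phi> n) :: real poly) = 1"
      using n \<Phi>[of n] lead_coeff_spread_cyclotomic[of n] by simp
    then show "lead_coeff (\<Phi> n) = 1" by simp
    have "map_poly of_int (\<Prod>d | d dvd n. \<Phi> d) = (\<Prod>d | d dvd n. spread_cyclotomic d)"
      unfolding of_int_poly_hom.hom_prod
      using n by (intro prod.cong refl \<Phi>) (auto intro: dvd_pos_nat)
    also have "\<dots> = map_poly of_int ((- 1) ^ (n - 1) * Z_poly n)"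
      using n Z_poly_eq_prod_spread_cyclotomic[of n] by simp
    finally show "(- 1) ^ (n - 1) * Z_poly n = (\<Prod>d | d dvd n. \<Phi> d)"
      by (simp only: of_int_poly_hom.eq_iff)
    fix d assume "d dvd n"
    then have "map_poly of_int (\<Phi> d) = spread_cyclotomic d"
      using n by (intro \<Phi>) (auto intro: dvd_pos_nat)
    then show "degree (\<Phi> d) = totient d"
      by (metis degree_spread_cyclotomic of_int_hom.degree_map_poly_hom)
  next
    have "map_poly of_int (\<Phi> 1) = (map_poly of_int [:0, 1:] :: real poly)"
      by (simp add: \<Phi> spread_cyclotomic_def spread_root_def of_int_hom.map_poly_pCons_hom)
    then show "\<Phi> 1 = [:0, 1:]" by (simp only: of_int_poly_hom.eq_iff)
    have "totatives 2 = {1 :: nat}" by (subst totatives_prime) auto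
    then have "map_poly of_int (\<Phi> 2) = (map_poly of_int [:- 4, 1:] :: real poly)"
      by (simp add: \<Phi> spread_cyclotomic_def spread_root_def of_int_hom.map_poly_pCons_hom)
    then show "\<Phi> 2 = [:- 4, 1:]" by (simp only: of_int_poly_hom.eq_iff)
    show "min_poly_rat (4 * (sin (pi / real 1))\<^sup>2) = [:0, 1:]"
      using min_poly_rat_of_rat[of 0] by simp
    show "min_poly_rat (4 * (sin (pi / real 2))\<^sup>2) = [:- 4, 1:]"
      using min_poly_rat_of_rat[of 4] by simp
  next
    fix n :: nat assume n: "n \<ge> 3"
    let ?m = "min_poly_rat (4 * (sin (pi / real n))\<^sup>2)"
    \<comment> \<open>The identity is proved over the reals, where both sides are products over
      spread roots, and then pulled back along the injective \<open>of_rat\<close>.\<close>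
    have "(map_poly of_rat (map_poly of_int (\<Phi> n)) :: real poly) = map_poly of_int (\<Phi> n)"
      by (rule poly_eqI) (simp add: coeff_map_poly)
    also have "\<dots> = (spread_half n)\<^sup>2" using n by (simp add: \<Phi> spread_cyclotomic_eq_square)
    also have "\<dots> = (map_poly of_rat ?m)\<^sup>2"
      using min_poly_rat_spread_root[OF n] by (simp add: spread_root_def)
    also have "\<dots> = map_poly of_rat (?m\<^sup>2)" 
      by (rule poly_eqI)
        (simp add: power2_eq_square coeff_mult coeff_map_poly of_rat_sum of_rat_mult)
    finally have "(of_rat (coeff (map_poly of_int (\<Phi> n)) i) :: real) = of_rat (coeff (?m\<^sup>2) i)" for i
      by (metis of_rat_hom.coeff_map_poly_hom)
    then show "map_poly of_int (\<Phi> n) = ?m\<^sup>2"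
      by (intro poly_eqI) (simp only: of_rat_eq_iff)
  qed
qed

end
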